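(* Fix $n\geq3$ and define $$X_{\tan}:[-0.1,0.1]^{n-1}\times[0.9,1.1]\times[-0.1,0.1]^{n-1}\to\mathbb{R}^{n-1},$$ $$X_{\tan}(w,t;y)=\bigl(w'-t^2y',\ \tan^{-1}(w_{n-1}/t)-t\,y_{n-1}\bigr),$$ where $w=(w',w_{n-1})$ and $y=(y',y_{n-1})$ with $w',y'\in\mathbb{R}^{n-2}$. If the linear Kakeya set conjecture holds in dimension $2n$, then $d_{\mathrm{Kak}}(X_{\tan})=n$.
   Context: Linear Kakeya set conjecture in dimension $N$: every compact subset of $\mathbb{R}^N$ containing a line segment in each direction has Hausdorff dimension $N$. For a smooth map $X:W\times I\times Y\to\mathbb{R}^{n-1}$, $(w,t,y)\mapsto X(w,t;y)$, with $W,Y\subset\mathbb{R}^{n-1}$ compact and $I\subset\mathbb{R}$ a compact interval, and $(y,w)\in Y\times W$, let $\gamma_{y,w}=\{(X(w,t;y),t):t\in I\}\subset\mathbb{R}^n$. An $X$-Kakeya set is a compact set $K\subset\mathbb{R}^n$ such that for each $y\in Y$ there is $w(y)\in W$ with $\gamma_{y,w(y)}\subset K$. Define $d_{\mathrm{Kak}}(X)=\inf\{\dim_{\mathrm H}K:K\text{ is an }X\text{-Kakeya set}\}$, where $\dim_{\mathrm H}$ is Hausdorff dimension. *)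

theory Defs
  imports "HOL-Analysis.Analysis"
begin

(* The summand of the s-dimensional Hausdorff (pre)measure, for bounded U. The convention
   diam(U)^0 = 1 for nonempty U is spelled out because 0 powr 0 = 0 in HOL. *)

definition hausdorff_gauge :: "real \<Rightarrow> 'a::metric_space set \<Rightarrow> ennreal" where
  "hausdorff_gauge s U =
    (if U = {} then 0 else if s = 0 then 1 else ennreal (diameter U powr s))"

(* Boundedness of the covering sets is required explicitly, since diameter is unspecified
   on unbounded sets. *)

definition hausdorff_premeasure :: "real \<Rightarrow> real \<Rightarrow> 'a::metric_space set \<Rightarrow> ennreal" where
  "hausdorff_premeasure s \<delta> A =
    (INF U \<in> {U :: nat \<Rightarrow> 'a set. A \<subseteq> (\<Union>i. U i) \<and> (\<forall>i. bounded (U i) \<and> diameter (U i) \<le> \<delta>)}.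
       \<Sum>i. hausdorff_gauge s (U i))"

definition hausdorff_measure :: "real \<Rightarrow> 'a::metric_space set \<Rightarrow> ennreal" where
  "hausdorff_measure s A = (SUP \<delta> \<in> {0<..}. hausdorff_premeasure s \<delta> A)"

definition hausdorff_dim :: "'a::metric_space set \<Rightarrow> ennreal" where
  "hausdorff_dim A = (INF s \<in> {s. 0 \<le> s \<and> hausdorff_measure s A = 0}. ennreal s)"

(* Segments are nondegenerate, but their length may depend on the direction. *)

definition contains_segment_in_each_direction :: "'a::euclidean_space set \<Rightarrow> bool" where
  "contains_segment_in_each_direction K \<longleftrightarrow>
    (\<forall>e. norm e = 1 \<longrightarrow> (\<exists>a r. 0 < r \<and> closed_segment a (a + r *\<^sub>R e) \<subseteq> K))"

definition linear_kakeya_set_conjecture :: "'a::euclidean_space itself \<Rightarrow> bool" where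
  "linear_kakeya_set_conjecture _ \<longleftrightarrow>
    (\<forall>K::'a set. compact K \<and> contains_segment_in_each_direction K
       \<longrightarrow> hausdorff_dim K = of_nat DIM('a))"

(* The space R^n is represented as the product of 'a = R^(n-1) with the real t-axis; the norm on
   a product type is the Euclidean one. *)

definition kakeya_curve ::
  "('a::euclidean_space \<Rightarrow> real \<Rightarrow> 'a \<Rightarrow> 'a) \<Rightarrow> real set \<Rightarrow> 'a \<Rightarrow> 'a \<Rightarrow> ('a \<times> real) set" where
  "kakeya_curve X I y w = {(X w t y, t) | t. t \<in> I}"

definition X_Kakeya_set ::
  "('a::euclidean_space \<Rightarrow> real \<Rightarrow> 'a \<Rightarrow> 'a) \<Rightarrow> 'a set \<Rightarrow> real set \<Rightarrow> 'a set \<Rightarrow> ('a \<times> real) set \<Rightarrow> bool"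
  where
  "X_Kakeya_set X W I Y K \<longleftrightarrow>
    compact K \<and> (\<forall>y\<in>Y. \<exists>w\<in>W. kakeya_curve X I y w \<subseteq> K)"

definition d_Kak ::
  "('a::euclidean_space \<Rightarrow> real \<Rightarrow> 'a \<Rightarrow> 'a) \<Rightarrow> 'a set \<Rightarrow> real set \<Rightarrow> 'a set \<Rightarrow> ennreal" where
  "d_Kak X W I Y = (INF K \<in> {K. X_Kakeya_set X W I Y K}. hausdorff_dim K)"

(* With CARD('m) = n - 2, the type (real^'m) * real is R^(n-1) split as (w', w_{n-1}). *)

definition X_tan ::
  "(real^'m::finite) \<times> real \<Rightarrow> real \<Rightarrow> (real^'m) \<times> real \<Rightarrow> (real^'m) \<times> real" where
  "X_tan w t y = (fst w - t\<^sup>2 *\<^sub>R fst y, arctan (snd w / t) - t * snd y)"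

definition tan_box :: "((real^'m::finite) \<times> real) set" where
  "tan_box = cbox (- (0.1 *\<^sub>R One)) (0.1 *\<^sub>R One)"

end

theory Submission
  imports Defs
begin

text \<open>
  Write \<open>((x', x), t)\<close> for a point of an \<open>X_tan\<close>-Kakeya set \<open>K\<close>, and add \<open>n\<close> coordinates
  \<open>(q, u, v)\<close>. Under \<open>p = x' + t q\<close> and \<open>\<theta> = arctan (u / v) - x\<close>, a line of
  \<open>(p, \<theta>, t, q, u, v)\<close>-space can be fitted over a curve of \<open>K\<close>: the line
  \<open>q = p\<^sub>1 + t y'\<close> turns \<open>x' = w' - t\<^sup>2 y'\<close> into \<open>p = w' + t p\<^sub>1\<close>, and rotating the line
  \<open>t + i w\<close> of the complex plane by the factor \<open>v\<^sub>1 + i u\<^sub>1\<close> adds the constant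
  \<open>arctan (u\<^sub>1 / v\<^sub>1)\<close> to \<open>arctan (w / t)\<close>, so that \<open>\<theta>\<close> becomes affine in \<open>t\<close>.
  As \<open>p\<^sub>1, u\<^sub>1, v\<^sub>1\<close> are free, the lines have all directions in an open set. The
  \<open>2n\<close>-dimensional set swept out is a Lipschitz image of \<open>K\<close> times an \<open>n\<close>-dimensional box, hence
  has dimension at most \<open>dim K + n\<close>, and finitely many rotated copies of it form a linear Kakeya set.
\<close>

text \<open>As a simp rule this makes the simplifier diverge on nested sums.\<close>

declare suminf_ennreal [simp del]

section \<open>Null sets in terms of countable ball covers\<close>

text \<open>For \<open>s > 0\<close> this says that the \<open>s\<close>-dimensional Hausdorff measure of \<open>A\<close> vanishes: a small
  sum forces small radii, so no bound on the radii is needed. Radius \<open>0\<close> is allowed.\<close>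

definition cover_null :: "real \<Rightarrow> 'a::metric_space set \<Rightarrow> bool" where
  "cover_null s A \<longleftrightarrow>
    (\<forall>\<epsilon>>0. \<exists>x r. A \<subseteq> (\<Union>i::nat. cball (x i) (r i)) \<and> (\<forall>i. 0 \<le> r i)
       \<and> (\<Sum>i. ennreal (r i powr s)) \<le> ennreal \<epsilon>)"

lemma cover_nullD:
  assumes "cover_null s A" "\<epsilon> > 0"
  obtains x r where "A \<subseteq> (\<Union>i::nat. cball (x i) (r i))" "\<And>i. 0 \<le> r i"
    "(\<Sum>i. ennreal (r i powr s)) \<le> ennreal \<epsilon>"
  using assms unfolding cover_null_def by (elim allE[of _ \<epsilon>] impE exE conjE) auto

text \<open>Reindexing along \<open>prod_decode\<close> merges a double sequence of balls into one
  sequence. Double sequences arise from countable unions and from subdividing each ball of a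
  cover.\<close>

lemma cover_null_doubleI:
  assumes "\<And>\<epsilon>. \<epsilon> > 0 \<Longrightarrow> \<exists>x r. A \<subseteq> (\<Union>i::nat. \<Union>j::nat. cball (x i j) (r i j)) \<and> (\<forall>i j. 0 \<le> r i j)
       \<and> (\<Sum>i. \<Sum>j. ennreal (r i j powr s)) \<le> ennreal \<epsilon>"
  shows "cover_null s A"
  unfolding cover_null_def
proof (intro allI impI)
  fix \<epsilon> :: real assume "\<epsilon> > 0"
  from assms[OF this] obtain x r where *: "A \<subseteq> (\<Union>i::nat. \<Union>j::nat. cball (x i j) (r i j))"
    "\<And>i j. 0 \<le> r i j" "(\<Sum>i. \<Sum>j. ennreal (r i j powr s)) \<le> ennreal \<epsilon>" by (elim exE conjE) auto
  define x' where "x' k = case_prod x (prod_decode k)" for k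
  define r' where "r' k = case_prod r (prod_decode k)" for k
  have "A \<subseteq> (\<Union>k. cball (x' k) (r' k))"
  proof
    fix a assume "a \<in> A"
    then obtain i j where "a \<in> cball (x i j) (r i j)" using *(1) by blast
    then have "a \<in> cball (x' (prod_encode (i, j))) (r' (prod_encode (i, j)))"
      by (simp add: x'_def r'_def)
    then show "a \<in> (\<Union>k. cball (x' k) (r' k))" by (rule UN_I[OF UNIV_I])
  qed
  moreover have "0 \<le> r' k" for k
    using *(2) by (simp add: r'_def split: prod.split)
  moreover have "(\<Sum>k. ennreal (r' k powr s)) = (\<Sum>i. \<Sum>j. ennreal (r i j powr s))"
    using suminf_ennreal_2dimen[of "\<lambda>i. \<Sum>j. ennreal (r i j powr s)" "\<lambda>(i, j). ennreal (r i j powr s)"]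
    by (simp add: r'_def case_prod_unfold)
  ultimately show "\<exists>x r. A \<subseteq> (\<Union>i::nat. cball (x i) (r i)) \<and> (\<forall>i. 0 \<le> r i)
       \<and> (\<Sum>i. ennreal (r i powr s)) \<le> ennreal \<epsilon>"
    using *(3) by (intro exI[of _ x'] exI[of _ r']) simp
qed

lemma suminf_geometric_half:
  assumes "0 \<le> (e::real)"
  shows "(\<Sum>i. ennreal (e * (1/2) ^ Suc i)) = ennreal e"
  using assms sums_mult[OF power_half_series, of e] by (intro suminf_ennreal_eq) auto

text \<open>The \<open>i\<close>-th set is covered at cost \<epsilon> / 2^(i+1), and these costs add
  up to \<epsilon>.\<close>

lemma cover_null_Union:
  fixes A :: "nat \<Rightarrow> 'a::metric_space set"
  assumes "\<And>i. cover_null s (A i)"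
  shows "cover_null s (\<Union>i. A i)"
proof (rule cover_null_doubleI)
  fix \<epsilon> :: real assume "\<epsilon> > 0"
  then have "\<exists>x r. A i \<subseteq> (\<Union>j::nat. cball (x j) (r j)) \<and> (\<forall>j. 0 \<le> r j)
       \<and> (\<Sum>j. ennreal (r j powr s)) \<le> ennreal (\<epsilon> * (1/2) ^ Suc i)" for i
    using assms[of i] unfolding cover_null_def by simp
  then obtain x r where *: "\<And>i. A i \<subseteq> (\<Union>j::nat. cball (x i j) (r i j))" "\<And>i j. 0 \<le> r i j"
     "\<And>i. (\<Sum>j. ennreal (r i j powr s)) \<le> ennreal (\<epsilon> * (1/2) ^ Suc i)" by metis
  have "(\<Sum>i. \<Sum>j. ennreal (r i j powr s)) \<le> (\<Sum>i. ennreal (\<epsilon> * (1/2) ^ Suc i))"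
    using *(3) by (intro suminf_le) auto
  also have "\<dots> = ennreal \<epsilon>" using \<open>\<epsilon> > 0\<close> by (intro suminf_geometric_half) simp
  finally have "(\<Sum>i. \<Sum>j. ennreal (r i j powr s)) \<le> ennreal \<epsilon>" .
  moreover have "(\<Union>i. A i) \<subseteq> (\<Union>i. \<Union>j. cball (x i j) (r i j))"
    using *(1) by (rule UN_mono[OF subset_refl])
  ultimately show "\<exists>x r. (\<Union>i. A i) \<subseteq> (\<Union>i::nat. \<Union>j::nat. cball (x i j) (r i j)) \<and> (\<forall>i j. 0 \<le> r i j)
       \<and> (\<Sum>i. \<Sum>j. ennreal (r i j powr s)) \<le> ennreal \<epsilon>"
    using *(2) by (intro exI[of _ x] exI[of _ r]) simp
qed

text \<open>\<open>from_nat_into\<close> enumerates a nonempty finite index set with repetitions,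
  which reduces this to a union over the naturals.\<close>

lemma cover_null_finite_UN:
  assumes "finite I" "I \<noteq> {}" "\<And>i. i \<in> I \<Longrightarrow> cover_null s (A i)"
  shows "cover_null s (\<Union>i\<in>I. A i)"
proof -
  have "(\<Union>i\<in>I. A i) = (\<Union>k. A (from_nat_into I k))"
    using range_from_nat_into[OF assms(2) countable_finite[OF assms(1)]] by (metis image_image)
  then show ?thesis
    using cover_null_Union[of s "\<lambda>k. A (from_nat_into I k)"] assms(2,3) by (simp add: from_nat_into)
qed

text \<open>The Lipschitz bound holds only between points of \<open>A\<close>, so each ball meeting
  \<open>A\<close> is first recentred at a point of \<open>A\<close>, at the price of a factor 2 in
  the radius.\<close>

lemma cover_null_lipschitz_image:
  fixes f :: "'a::metric_space \<Rightarrow> 'b::metric_space"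
  assumes "cover_null s A" "L-lipschitz_on A f" "s > 0"
  shows "cover_null s (f ` A)"
  unfolding cover_null_def
proof (intro allI impI)
  fix \<epsilon> :: real assume "\<epsilon> > 0"
  \<comment> \<open>The 2 comes from recentring; the summand 1 keeps \<open>M\<close> positive even
    if \<open>L = 0\<close>.\<close>
  define M where "M = 2 * L + 1"
  have L: "0 \<le> L" using assms(2) lipschitz_on_nonneg by blast
  then have M: "M > 0" by (simp add: M_def)
  then have "\<epsilon> / M powr s > 0" using \<open>\<epsilon> > 0\<close> by simp
  from cover_nullD[OF assms(1) this] obtain x r where *: "A \<subseteq> (\<Union>i::nat. cball (x i) (r i))"
    "\<And>i. 0 \<le> r i" "(\<Sum>i. ennreal (r i powr s)) \<le> ennreal (\<epsilon> / M powr s)" by blast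
  \<comment> \<open>If the ball misses \<open>A\<close>, \<open>c i\<close> is arbitrary; such a
    ball covers no point of \<open>A\<close>.\<close>
  define c where "c i = (SOME a. a \<in> A \<inter> cball (x i) (r i))" for i
  have "f ` A \<subseteq> (\<Union>i. cball (f (c i)) (M * r i))"
  proof
    fix b assume "b \<in> f ` A"
    then obtain a where a: "a \<in> A" "b = f a" by blast
    then obtain i where i: "a \<in> cball (x i) (r i)" using *(1) by blast
    have c: "c i \<in> A \<inter> cball (x i) (r i)"
      unfolding c_def by (rule someI[of _ a]) (use a i in auto)
    have "dist (f (c i)) b \<le> L * dist (c i) a"
      using assms(2) a c by (auto intro: lipschitz_onD)
    also have "\<dots> \<le> L * (2 * r i)"
      using c i dist_triangle3[of "c i" a "x i"] L by (intro mult_left_mono) auto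
    also have "\<dots> \<le> M * r i" using *(2)[of i] by (simp add: M_def algebra_simps)
    finally show "b \<in> (\<Union>i. cball (f (c i)) (M * r i))" by auto
  qed
  moreover have "(\<Sum>i. ennreal ((M * r i) powr s)) \<le> ennreal \<epsilon>"
  proof -
    have "(\<Sum>i. ennreal ((M * r i) powr s)) = (\<Sum>i. ennreal (M powr s) * ennreal (r i powr s))"
      using M *(2) by (simp add: powr_mult ennreal_mult)
    also have "\<dots> = ennreal (M powr s) * (\<Sum>i. ennreal (r i powr s))" by simp
    also have "\<dots> \<le> ennreal (M powr s) * ennreal (\<epsilon> / M powr s)"
      using *(3) by (intro mult_left_mono) auto
    also have "\<dots> = ennreal \<epsilon>" using M by (simp flip: ennreal_mult')
    finally show ?thesis .
  qed
  ultimately show "\<exists>x r. f ` A \<subseteq> (\<Union>i::nat. cball (x i) (r i)) \<and> (\<forall>i. 0 \<le> r i)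
       \<and> (\<Sum>i. ennreal (r i powr s)) \<le> ennreal \<epsilon>"
    using *(2) M by (intro exI[of _ "\<lambda>i. f (c i)"] exI[of _ "\<lambda>i. M * r i"]) auto
qed

section \<open>Comparison with Hausdorff measure and dimension\<close>

text \<open>A bounded set lies in the ball about any of its points whose radius is its diameter, so
  the cost of the cover does not change.\<close>

lemma cover_null_if_hausdorff_measure_0:
  assumes "hausdorff_measure s A = 0" "s > 0"
  shows "cover_null s A"
  unfolding cover_null_def
proof (intro allI impI)
  fix \<epsilon> :: real assume "\<epsilon> > 0"
  have "hausdorff_premeasure s 1 A \<le> hausdorff_measure s A"
    unfolding hausdorff_measure_def by (intro SUP_upper) auto
  then have "hausdorff_premeasure s 1 A < ennreal \<epsilon>" using assms \<open>\<epsilon> > 0\<close> by simp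
  then obtain U where U: "A \<subseteq> (\<Union>i::nat. U i)" "\<And>i. bounded (U i)"
    "(\<Sum>i. hausdorff_gauge s (U i)) < ennreal \<epsilon>"
    unfolding hausdorff_premeasure_def INF_less_iff by auto
  define c where "c i = (SOME a. a \<in> U i)" for i
  \<comment> \<open>Radius 0 for an empty set agrees with its gauge 0, as
    \<open>0 powr s = 0\<close>.\<close>
  define r where "r i = (if U i = {} then 0 else diameter (U i))" for i
  have r0: "0 \<le> r i" for i using U(2) diameter_ge_0 by (auto simp: r_def)
  have "U i \<subseteq> cball (c i) (r i)" for i
  proof
    fix a assume a: "a \<in> U i"
    then have "c i \<in> U i" unfolding c_def by (metis someI)
    then show "a \<in> cball (c i) (r i)"
      using diameter_bounded_bound[OF U(2)[of i], of "c i" a] a by (auto simp: r_def)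
  qed
  then have "(\<Union>i. U i) \<subseteq> (\<Union>i. cball (c i) (r i))" by (intro UN_mono) simp_all
  then have "A \<subseteq> (\<Union>i. cball (c i) (r i))" using U(1) by (rule order_trans[rotated])
  moreover have "hausdorff_gauge s (U i) = ennreal (r i powr s)" for i
    using assms(2) by (simp add: hausdorff_gauge_def r_def)
  then have "(\<Sum>i. ennreal (r i powr s)) \<le> ennreal \<epsilon>" using U(3) by simp
  ultimately show "\<exists>x r. A \<subseteq> (\<Union>i::nat. cball (x i) (r i)) \<and> (\<forall>i. 0 \<le> r i)
       \<and> (\<Sum>i. ennreal (r i powr s)) \<le> ennreal \<epsilon>"
    using r0 by (intro exI[of _ c] exI[of _ r]) simp
qed

text \<open>For exponent 0 every nonempty covering set costs 1, so a cover of total cost below 1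
  consists of empty sets.\<close>

lemma empty_if_hausdorff_measure_0:
  assumes "hausdorff_measure 0 A = 0"
  shows "A = {}"
proof -
  have "hausdorff_premeasure 0 1 A \<le> hausdorff_measure 0 A"
    unfolding hausdorff_measure_def by (intro SUP_upper) auto
  then have "hausdorff_premeasure 0 1 A < 1" using assms by simp
  then obtain U where U: "A \<subseteq> (\<Union>i::nat. U i)" "(\<Sum>i. hausdorff_gauge 0 (U i)) < 1"
    unfolding hausdorff_premeasure_def INF_less_iff by auto
  have "hausdorff_gauge 0 (U i) < 1" for i using ennreal_suminf_lessD[OF U(2)] .
  then have "U i = {}" for i by (metis hausdorff_gauge_def less_irrefl)
  then show ?thesis using U(1) by auto
qed

text \<open>Each single term is bounded by the whole sum, so a cheap cover automatically has small
  radii and is admissible at the scale \<delta>.\<close>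

lemma hausdorff_measure_0_if_cover_null:
  assumes "cover_null s A" "s > 0"
  shows "hausdorff_measure s A = 0"
proof -
  have "hausdorff_premeasure s \<delta> A \<le> ennreal e" if \<delta>: "\<delta> > 0" and e: "e > 0" for \<delta> e :: real
  proof -
    \<comment> \<open>The first bound forces \<open>2 * r i\<close> to be at most \<delta>; the
      second absorbs the factor \<open>2 powr s\<close> from passing to diameters.\<close>
    define \<epsilon> where "\<epsilon> = min ((\<delta> / 2) powr s) (e / 2 powr s)"
    have "\<epsilon> > 0" using \<delta> e by (simp add: \<epsilon>_def)
    from cover_nullD[OF assms(1) this] obtain x r where *: "A \<subseteq> (\<Union>i::nat. cball (x i) (r i))"
      "\<And>i. 0 \<le> r i" "(\<Sum>i. ennreal (r i powr s)) \<le> ennreal \<epsilon>" by blast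
    have diam: "diameter (cball (x i) (r i)) \<le> 2 * r i" for i
    proof -
      have ne: "cball (x i) (r i) \<noteq> {}" using *(2)[of i] by simp
      then have "diameter (cball (x i) (r i)) = (SUP (a, b)\<in>cball (x i) (r i) \<times> cball (x i) (r i). dist a b)"
        unfolding diameter_def by simp
      also have "\<dots> \<le> 2 * r i"
      proof (rule cSUP_least)
        fix z assume "z \<in> cball (x i) (r i) \<times> cball (x i) (r i)"
        then show "(case z of (a, b) \<Rightarrow> dist a b) \<le> 2 * r i"
          using dist_triangle3[of "fst z" "snd z" "x i"] by (auto simp: case_prod_unfold)
      qed (use ne in blast)
      finally show ?thesis .
    qed
    have "2 * r i \<le> \<delta>" for i
    proof -
      have "ennreal (r i powr s) \<le> ennreal \<epsilon>"
        using *(3) sum_le_suminf[of "\<lambda>i. ennreal (r i powr s)" "{i}"] by (simp add: order_trans)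
      then have "r i powr s \<le> (\<delta> / 2) powr s" using \<open>\<epsilon> > 0\<close> by (simp add: \<epsilon>_def)
      then show ?thesis using assms(2) \<delta> *(2)[of i]
        by (smt (verit) powr_less_mono2 field_sum_of_halves)
    qed
    then have "diameter (cball (x i) (r i)) \<le> \<delta>" for i using diam[of i] order_trans by blast
    then have "hausdorff_premeasure s \<delta> A \<le> (\<Sum>i. hausdorff_gauge s (cball (x i) (r i)))"
      unfolding hausdorff_premeasure_def using *(1)
      by (intro INF_lower) simp
    also have "\<dots> \<le> (\<Sum>i. ennreal (2 powr s) * ennreal (r i powr s))"
    proof (intro suminf_le allI)
      fix i
      have "diameter (cball (x i) (r i)) powr s \<le> (2 * r i) powr s"
        using diam[of i] diameter_ge_0[OF bounded_cball] assms(2) by (intro powr_mono2) auto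
      also have "\<dots> = 2 powr s * r i powr s" using *(2) by (simp add: powr_mult)
      finally show "hausdorff_gauge s (cball (x i) (r i)) \<le> ennreal (2 powr s) * ennreal (r i powr s)"
        using assms(2) by (simp add: hausdorff_gauge_def ennreal_leI flip: ennreal_mult)
    qed auto
    also have "\<dots> = ennreal (2 powr s) * (\<Sum>i. ennreal (r i powr s))" by simp
    also have "\<dots> \<le> ennreal (2 powr s) * ennreal (e / 2 powr s)"
      using *(3) by (intro mult_left_mono order_trans[OF *(3)]) (auto simp: \<epsilon>_def e intro!: ennreal_leI)
    also have "\<dots> = ennreal e" by (simp flip: ennreal_mult')
    finally show ?thesis .
  qed
  then have "hausdorff_premeasure s \<delta> A \<le> 0 + ennreal e" if "\<delta> > 0" "e > 0" for \<delta> e :: real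
    using that by simp
  then have "hausdorff_premeasure s \<delta> A \<le> 0" if "\<delta> > 0" for \<delta> :: real
    using that ennreal_le_epsilon by blast
  then have "hausdorff_measure s A \<le> 0"
    unfolding hausdorff_measure_def by (intro SUP_least) simp
  then show ?thesis by simp
qed

lemma cover_null_empty: "s > 0 \<Longrightarrow> cover_null s {}"
  unfolding cover_null_def
  by (rule allI, rule impI, rule exI[of _ "\<lambda>_. undefined"], rule exI[of _ "\<lambda>_. 0"]) simp

lemma hausdorff_dim_le:
  assumes "cover_null s A" "s > 0"
  shows "hausdorff_dim A \<le> ennreal s"
  unfolding hausdorff_dim_def using hausdorff_measure_0_if_cover_null[OF assms] assms(2)
  by (intro INF_lower) auto

text \<open>The exponent witnessing the infimum may be 0. Then the set is empty, and any positive
  exponent below \<open>c\<close> serves instead.\<close>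

lemma cover_null_if_hausdorff_dim_less:
  assumes "hausdorff_dim A < c"
  obtains s where "s > 0" "ennreal s < c" "cover_null s A"
proof -
  obtain s where s: "0 \<le> s" "hausdorff_measure s A = 0" "ennreal s < c"
    using assms unfolding hausdorff_dim_def INF_less_iff by auto
  show thesis
  proof (cases "s = 0")
    case True
    then have "A = {}" using s empty_if_hausdorff_measure_0 by blast
    moreover obtain s' where "0 < s'" "ennreal s' < c"
    proof -
      obtain y where y: "0 < y" "y < c" using dense[of 0 c] s(3) True by auto
      then have "y < top" using less_le_trans top_greatest by blast
      then have "ennreal (enn2real y) = y" "0 < enn2real y" using y by (simp_all add: enn2real_positive_iff)
      then show thesis using y(2) by (intro that[of "enn2real y"]) simp_all
    qed
    ultimately show thesis using that cover_null_empty by blast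
  next
    case False
    then have "s > 0" using s(1) by simp
    then show thesis using s(2,3) by (intro that[of s] cover_null_if_hausdorff_measure_0)
  qed
qed

section \<open>Products with bounded Euclidean sets\<close>

text \<open>A cubic grid of mesh proportional to \<open>r\<close> needs on the order of
  \<open>r powr - DIM('b)\<close> points, with a constant independent of \<open>r\<close>.\<close>

lemma bounded_grid_cover:
  fixes B :: "'b::euclidean_space set"
  assumes "bounded B"
  obtains C where "C > 0" "\<And>r. 0 < r \<Longrightarrow> r \<le> 1 \<Longrightarrow> \<exists>(c::nat \<Rightarrow> 'b) N.
     real N \<le> C * r powr - real DIM('b) \<and> B \<subseteq> (\<Union>j<N. cball (c j) r)"
proof -
  obtain M where M: "M > 0" "\<And>b. b \<in> B \<Longrightarrow> norm b \<le> M"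
    using assms by (auto simp: bounded_pos)
  define n where "n = DIM('b)"
  have n: "n > 0" by (simp add: n_def)
  \<comment> \<open>With \<open>m\<close> at most \<open>M * n / r + 2\<close>, the count
    \<open>(2 * m + 1) ^ n\<close> is at most \<open>C / r ^ n\<close>, because \<open>5\<close> is
    at most \<open>5 / r\<close>.\<close>
  define C where "C = (2 * M * real n + 5) ^ n"
  have "\<exists>(c::nat \<Rightarrow> 'b) N. real N \<le> C * r powr - real n \<and> B \<subseteq> (\<Union>j<N. cball (c j) r)"
    if r: "0 < r" "r \<le> 1" for r
  proof -
    \<comment> \<open>Rounding changes each of the \<open>n\<close> coordinates by at most
      \<open>h\<close>, hence moves the point by at most \<open>n * h = r\<close>.\<close>
    define h where "h = r / n"
    have h: "h > 0" using r n by (simp add: h_def)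
    define m where "m = \<lceil>M / h\<rceil> + 1"
    have "M / h > 0" using M h by simp
    then have m0: "m > 0" unfolding m_def by linarith
    define I :: "('b \<Rightarrow> int) set" where "I = Basis \<rightarrow>\<^sub>E {-m..m}"
    define g where "g k = (\<Sum>b\<in>Basis. (h * of_int (k b)) *\<^sub>R (b::'b))" for k :: "'b \<Rightarrow> int"
    define F where "F = g ` I"
    have fin: "finite F" by (simp add: F_def I_def finite_PiE)
    have "card F \<le> card I" unfolding F_def by (intro card_image_le) (simp add: I_def finite_PiE)
    also have "card I = nat (2 * m + 1) ^ n" by (simp add: I_def card_PiE n_def)
    finally have "real (card F) \<le> real (nat (2 * m + 1) ^ n)" by (simp only: of_nat_le_iff)
    also have "\<dots> = (2 * real_of_int m + 1) ^ n" using m0 by simp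
    also have "\<dots> \<le> ((2 * M * n + 5) / r) ^ n"
    proof (intro power_mono)
      have "real_of_int m \<le> M / h + 2" unfolding m_def by linarith
      also have "\<dots> = M * n / r + 2" by (simp add: h_def)
      finally have "2 * real_of_int m + 1 \<le> 2 * (M * n / r) + 5" by simp
      also have "\<dots> \<le> 2 * (M * n / r) + 5 / r" using r by (simp add: field_simps)
      also have "\<dots> = (2 * M * n + 5) / r" using r by (simp add: field_simps)
      finally show "2 * real_of_int m + 1 \<le> (2 * M * n + 5) / r" .
    qed (use m0 in auto)
    also have "\<dots> = C * r powr - real n"
      unfolding C_def power_divide powr_minus powr_realpow[OF r(1)] by (rule divide_inverse)
    finally have card: "real (card F) \<le> C * r powr - real n" .
    obtain c where c: "bij_betw c {0..<card F} F" using ex_bij_betw_nat_finite[OF fin] by blast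
    have cover: "B \<subseteq> (\<Union>a\<in>F. cball a r)"
    proof
      fix x assume x: "x \<in> B"
      define k where "k = (\<lambda>b\<in>Basis. \<lfloor>(x \<bullet> b) / h\<rfloor>)"
      have "k b \<in> {-m..m}" if b: "b \<in> Basis" for b
      proof -
        have "\<bar>x \<bullet> b\<bar> \<le> M" using M(2)[OF x] Basis_le_norm[OF b, of x] by linarith
        then have "\<bar>(x \<bullet> b) / h\<bar> \<le> M / h" using h by (simp add: abs_divide divide_right_mono)
        moreover have "M / h + 1 \<le> of_int m"
          using le_of_int_ceiling[of "M / h"] by (simp add: m_def)
        ultimately have "(x \<bullet> b) / h < of_int m + 1" "- of_int m \<le> (x \<bullet> b) / h"
          by (simp_all only: abs_le_iff) linarith+
        then have "\<lfloor>(x \<bullet> b) / h\<rfloor> \<le> m" "- m \<le> \<lfloor>(x \<bullet> b) / h\<rfloor>"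
          by (simp_all only: floor_le_iff le_floor_iff of_int_minus)
        moreover have "k b = \<lfloor>(x \<bullet> b) / h\<rfloor>" using b by (simp only: k_def restrict_apply' if_True)
        ultimately show ?thesis by (simp only: atLeastAtMost_iff)
      qed
      then have kI: "k \<in> I" unfolding I_def k_def by (intro PiE_I) auto
      have "norm (x - g k) = norm (\<Sum>b\<in>Basis. (x \<bullet> b - h * of_int (k b)) *\<^sub>R b)"
        by (subst euclidean_representation[of x, symmetric])
           (simp add: g_def scaleR_diff_left sum_subtractf)
      also have "\<dots> \<le> (\<Sum>b\<in>(Basis::'b set). h)"
      proof (intro sum_norm_le)
        fix b :: 'b assume b: "b \<in> Basis"
        have "x \<bullet> b - h * of_int (k b) = h * ((x \<bullet> b) / h - of_int \<lfloor>(x \<bullet> b) / h\<rfloor>)"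
          using h b by (simp add: k_def right_diff_distrib)
        also have "\<bar>\<dots>\<bar> \<le> h * 1"
          unfolding abs_mult using h by (intro mult_mono) (auto, linarith)
        finally show "norm ((x \<bullet> b - h * of_int (k b)) *\<^sub>R b) \<le> h" using b by simp
      qed
      also have "\<dots> = r" using n by (simp add: h_def n_def)
      finally have "x \<in> cball (g k) r" by (simp add: dist_norm norm_minus_commute)
      then show "x \<in> (\<Union>a\<in>F. cball a r)" 
        using kI by (intro UN_I[of "g k"]) (simp_all add: F_def)
    qed
    have "F = c ` {..<card F}" using c by (simp add: bij_betw_def atLeast0LessThan)
    then have "(\<Union>a\<in>F. cball a r) = (\<Union>a\<in>c ` {..<card F}. cball a r)" by (rule arg_cong)
    then have "B \<subseteq> (\<Union>j<card F. cball (c j) r)" using cover by (simp only: image_image)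
    then show ?thesis using card by (intro exI[of _ c] exI[of _ "card F"] conjI)
  qed
  moreover have "C > 0" unfolding C_def using M(1) by (intro zero_less_power add_nonneg_pos) simp_all
  ultimately show thesis using that by (simp add: n_def)
qed

text \<open>The radii of a cover may vanish; they are first enlarged, since a ball of radius \<open>r > 0\<close>
  times \<open>B\<close> splits into about \<open>r powr - n\<close> balls of radius \<open>2 r\<close>.\<close>

lemma cover_null_Times:
  fixes B :: "'b::euclidean_space set"
  assumes "cover_null s A" "s > 0" "bounded B"
  shows "cover_null (s + real DIM('b)) (A \<times> B)"
proof (rule cover_null_doubleI)
  fix \<epsilon> :: real assume \<epsilon>: "\<epsilon> > 0"
  define n where "n = real DIM('b)"
  obtain C where C: "C > 0" "\<And>r. 0 < r \<Longrightarrow> r \<le> 1 \<Longrightarrow> \<exists>(c::nat \<Rightarrow> 'b) N.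
     real N \<le> C * r powr - n \<and> B \<subseteq> (\<Union>j<N. cball (c j) r)"
    unfolding n_def using bounded_grid_cover[OF assms(3)] by blast
  \<comment> \<open>About \<open>C * q powr - n\<close> balls of radius \<open>2 * q\<close> cost
    \<open>D * q powr s\<close> in the exponent \<open>s + n\<close>.\<close>
  define D where "D = C * 2 powr (s + n)"
  have D: "D > 0" using C by (simp add: D_def)
  \<comment> \<open>The cost after enlarging radii will be \<open>2 * \<eta>\<close>: at most 1, so
    that the radii stay in the range of the grid cover, and at most \<epsilon> after multiplication
    by \<open>D\<close>.\<close>
  define \<eta> where "\<eta> = min 1 (\<epsilon> / D) / 2"
  have \<eta>: "\<eta> > 0" "2 * \<eta> \<le> 1" "D * (2 * \<eta>) \<le> \<epsilon>" using D \<epsilon> by (auto simp: \<eta>_def min_def field_simps)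
  obtain x r where *: "A \<subseteq> (\<Union>i::nat. cball (x i) (r i))"
      "\<And>i. 0 \<le> r i" "(\<Sum>i. ennreal (r i powr s)) \<le> ennreal \<eta>"
    using cover_nullD[OF assms(1) \<eta>(1)] by blast
  \<comment> \<open>The \<open>s\<close>-th power of the second term is \<eta> / 2^(i+1), so the
    enlargement adds at most \<eta> in total.\<close>
  define q where "q i = max (r i) ((\<eta> * (1/2) ^ Suc i) powr (1 / s))" for i
  have q0: "q i > 0" for i using \<eta> by (auto simp: q_def less_max_iff_disj)
  have qs: "q i powr s \<le> r i powr s + \<eta> * (1/2) ^ Suc i" for i
    using \<eta> assms(2) by (auto simp: q_def max_def powr_powr)
  have "(\<Sum>i. ennreal (q i powr s)) \<le> (\<Sum>i. ennreal (r i powr s) + ennreal (\<eta> * (1/2) ^ Suc i))"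
    using \<eta> qs by (intro suminf_le allI) (auto simp flip: ennreal_plus intro!: ennreal_leI)
  also have "\<dots> = (\<Sum>i. ennreal (r i powr s)) + (\<Sum>i. ennreal (\<eta> * (1/2) ^ Suc i))"
    by (intro suminf_add[symmetric]) auto
  also have "\<dots> \<le> ennreal \<eta> + ennreal \<eta>"
    using *(3) \<eta> by (subst suminf_geometric_half) auto
  also have "\<dots> = ennreal (2 * \<eta>)" using \<eta> by (simp flip: ennreal_plus)
  finally have qsum: "(\<Sum>i. ennreal (q i powr s)) \<le> ennreal (2 * \<eta>)" .
  have q1: "q i \<le> 1" for i
  proof -
    have "ennreal (q i powr s) \<le> ennreal (2 * \<eta>)"
      using qsum sum_le_suminf[of "\<lambda>i. ennreal (q i powr s)" "{i}"] by (simp add: order_trans)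
    then have "q i powr s \<le> 1 powr s" using \<eta> by simp
    then show ?thesis using assms(2) q0[of i] by (smt (verit) powr_less_mono2)
  qed
  have "\<exists>(c::nat \<Rightarrow> 'b) N. real N \<le> C * q i powr - n \<and> B \<subseteq> (\<Union>j<N. cball (c j) (q i))" for i
    using C(2)[OF q0 q1] .
  then obtain c :: "nat \<Rightarrow> nat \<Rightarrow> 'b" and N
    where cN: "\<And>i. real (N i) \<le> C * q i powr - n" "\<And>i. B \<subseteq> (\<Union>j<N i. cball (c i j) (q i))"
    by metis
  \<comment> \<open>A point of the product is within \<open>r i + q i\<close>, hence within
    \<open>2 * q i\<close>, of a centre. Surplus indices get radius 0 and cost nothing.\<close>
  define R where "R i j = (if j < N i then 2 * q i else 0)" for i j
  have "A \<times> B \<subseteq> (\<Union>i. \<Union>j. cball (x i, c i j) (R i j))"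
  proof
    fix z assume "z \<in> A \<times> B"
    then obtain a b where z: "z = (a, b)" "a \<in> A" "b \<in> B" by auto
    obtain i where i: "a \<in> cball (x i) (r i)" using *(1) z by blast
    obtain j where j: "j < N i" "b \<in> cball (c i j) (q i)" using cN(2) z by blast
    have "dist (x i, c i j) z \<le> dist (x i) a + dist (c i j) b"
      unfolding z dist_Pair_Pair by (intro sqrt_sum_squares_le_sum) auto
    also have "\<dots> \<le> R i j" using i j by (simp add: R_def q_def)
    finally show "z \<in> (\<Union>i. \<Union>j. cball (x i, c i j) (R i j))" by auto
  qed
  moreover have "0 \<le> R i j" for i j using q0[of i] by (simp add: R_def)
  moreover have "(\<Sum>i. \<Sum>j. ennreal (R i j powr (s + n))) \<le> ennreal \<epsilon>"
  proof -
    have "(\<Sum>j. ennreal (R i j powr (s + n))) \<le> ennreal D * ennreal (q i powr s)" for i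
    proof -
      have "(\<Sum>j. ennreal (R i j powr (s + n))) = (\<Sum>j<N i. ennreal (R i j powr (s + n)))"
        by (intro suminf_finite) (auto simp: R_def)
      also have "\<dots> = (\<Sum>j<N i. ennreal ((2 * q i) powr (s + n)))"
        by (intro sum.cong) (auto simp: R_def)
      also have "\<dots> = ennreal (real (N i) * (2 * q i) powr (s + n))"
        by (simp add: ennreal_mult ennreal_of_nat_eq_real_of_nat)
      also have "real (N i) * (2 * q i) powr (s + n) \<le> C * q i powr - n * (2 * q i) powr (s + n)"
        using cN(1) by (intro mult_right_mono) auto
      also have "\<dots> = D * q i powr s"
        using q0[of i] by (simp add: D_def powr_mult powr_add powr_minus field_simps)
      finally show ?thesis using D by (simp add: ennreal_mult ennreal_leI)
    qed
    then have "(\<Sum>i. \<Sum>j. ennreal (R i j powr (s + n))) \<le> (\<Sum>i. ennreal D * ennreal (q i powr s))"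
      by (intro suminf_le) auto
    also have "\<dots> = ennreal D * (\<Sum>i. ennreal (q i powr s))" by simp
    also have "\<dots> \<le> ennreal D * ennreal (2 * \<eta>)" using qsum by (intro mult_left_mono) auto
    also have "\<dots> \<le> ennreal \<epsilon>" using \<eta> D by (simp add: ennreal_leI flip: ennreal_mult')
    finally show ?thesis .
  qed
  ultimately show "\<exists>x r. A \<times> B \<subseteq> (\<Union>i::nat. \<Union>j::nat. cball (x i j) (r i j)) \<and> (\<forall>i j. 0 \<le> r i j)
       \<and> (\<Sum>i. \<Sum>j. ennreal (r i j powr (s + real DIM('b)))) \<le> ennreal \<epsilon>"
    unfolding n_def by (intro exI[of _ "\<lambda>i j. (x i, c i j)"] exI[of _ R]) auto
qed

text \<open>A single point is null for every exponent \<open>e > 0\<close>; its product with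
  \<open>B\<close> is null for \<open>e + DIM('b)\<close>, and projecting recovers
  \<open>B\<close>.\<close>

lemma hausdorff_dim_bounded_le:
  fixes B :: "'b::euclidean_space set"
  assumes "bounded B"
  shows "hausdorff_dim B \<le> of_nat DIM('b)"
proof (rule ennreal_le_epsilon)
  fix e :: real assume e: "0 < e"
  have "cover_null e {0::real}"
    unfolding cover_null_def
    by (rule allI, rule impI, rule exI[of _ "\<lambda>_. 0"], rule exI[of _ "\<lambda>_. 0"]) simp
  then have "cover_null (e + DIM('b)) ({0::real} \<times> B)" using e assms by (rule cover_null_Times)
  moreover have "1-lipschitz_on ({0::real} \<times> B) snd"
    by (intro lipschitz_onI) (simp_all add: dist_snd_le)
  ultimately have "cover_null (e + DIM('b)) (snd ` ({0::real} \<times> B))"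
    using e by (intro cover_null_lipschitz_image) auto
  then have "hausdorff_dim B \<le> ennreal (e + DIM('b))" using e by (intro hausdorff_dim_le) auto
  also have "\<dots> = of_nat DIM('b) + ennreal e"
    using e by (simp add: ennreal_of_nat_eq_real_of_nat add.commute)
  finally show "hausdorff_dim B \<le> of_nat DIM('b) + ennreal e" .
qed

section \<open>The straightening map and its Lipschitz bound\<close>

text \<open>The product rule: one factor is varied at a time while the other is bounded.\<close>

lemma lipschitz_on_scaleR:
  fixes f :: "'a::metric_space \<Rightarrow> real" and g :: "'a \<Rightarrow> 'b::real_normed_vector"
  assumes f: "L-lipschitz_on A f" "\<And>x. x \<in> A \<Longrightarrow> \<bar>f x\<bar> \<le> C" "0 \<le> C"
    and g: "M-lipschitz_on A g" "\<And>x. x \<in> A \<Longrightarrow> norm (g x) \<le> D" "0 \<le> D"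
  shows "(C * M + L * D)-lipschitz_on A (\<lambda>x. f x *\<^sub>R g x)"
proof (rule lipschitz_onI)
  have LM: "0 \<le> L" "0 \<le> M" using f g lipschitz_on_nonneg by blast+
  then show "0 \<le> C * M + L * D" using f g by simp
  fix x y assume xy: "x \<in> A" "y \<in> A"
  have "f x *\<^sub>R g x - f y *\<^sub>R g y = f x *\<^sub>R (g x - g y) + (f x - f y) *\<^sub>R g y"
    by (simp add: algebra_simps)
  then have "dist (f x *\<^sub>R g x) (f y *\<^sub>R g y)
      \<le> norm (f x *\<^sub>R (g x - g y)) + norm ((f x - f y) *\<^sub>R g y)"
    unfolding dist_norm by (simp only: norm_triangle_ineq)
  also have "\<dots> = \<bar>f x\<bar> * dist (g x) (g y) + dist (f x) (f y) * norm (g y)"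
    by (simp add: dist_norm)
  also have "\<dots> \<le> C * (M * dist x y) + (L * dist x y) * D"
    using f g LM lipschitz_onD[OF f(1) xy] lipschitz_onD[OF g(1) xy] xy
    by (intro add_mono mult_mono) auto
  also have "\<dots> = (C * M + L * D) * dist x y" by (simp add: algebra_simps)
  finally show "dist (f x *\<^sub>R g x) (f y *\<^sub>R g y) \<le> (C * M + L * D) * dist x y" .
qed

lemma lipschitz_on_fst: "1-lipschitz_on A fst"
  by (intro lipschitz_onI) (simp_all add: dist_fst_le)

lemma lipschitz_on_snd: "1-lipschitz_on A snd"
  by (intro lipschitz_onI) (simp_all add: dist_snd_le)

lemma lipschitz_on_arctan: "1-lipschitz_on A (arctan :: real \<Rightarrow> real)"
proof (rule lipschitz_onI)
  fix x y :: real
  have "norm (arctan x - arctan y) \<le> 1 * norm (x - y)"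
  proof (rule field_differentiable_bound[of UNIV])
    fix z :: real
    show "(arctan has_field_derivative inverse (1 + z\<^sup>2)) (at z within UNIV)"
      by (rule DERIV_arctan)
    have "1 \<le> 1 + z\<^sup>2" by simp
    then have "inverse (1 + z\<^sup>2) \<le> inverse 1" by (intro le_imp_inverse_le) simp_all
    moreover have "0 \<le> inverse (1 + z\<^sup>2)" by simp
    ultimately show "norm (inverse (1 + z\<^sup>2)) \<le> 1" by simp
  qed simp_all
  then show "dist (arctan x) (arctan y) \<le> 1 * dist x y" by (simp only: dist_norm)
qed simp

lemma lipschitz_on_inverse: "4-lipschitz_on {1/2..} (inverse :: real \<Rightarrow> real)"
proof (rule lipschitz_onI)
  fix x y :: real assume xy: "x \<in> {1/2..}" "y \<in> {1/2..}"
  then have "1/2 * (1/2) \<le> x * y" by (intro mult_mono) simp_all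
  then have "\<bar>x - y\<bar> * 1 \<le> \<bar>x - y\<bar> * (4 * (x * y))" by (intro mult_left_mono) simp_all
  moreover have "inverse x - inverse y = (y - x) / (x * y)" using xy by (simp add: field_simps)
  ultimately show "dist (inverse x) (inverse y) \<le> 4 * dist x y"
    using xy by (simp add: dist_real_def abs_divide abs_mult abs_minus_commute field_simps)
qed simp

definition straighten ::
  "(('v::real_normed_vector \<times> real) \<times> real) \<times> ('v \<times> real \<times> real)
    \<Rightarrow> (('v \<times> real) \<times> real) \<times> ('v \<times> real \<times> real)" where
  "straighten = (\<lambda>(((x', x), t), (q, u, v)). (((x' + t *\<^sub>R q, arctan (u / v) - x), t), (q, u, v)))"

text \<open>Keeping \<open>v\<close> at least \<open>1/2\<close> makes \<open>u / v\<close>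
  Lipschitz, while the box is large enough for all lines with direction near the central
  one.\<close>

definition fibre_box :: "('v::real_normed_vector \<times> real \<times> real) set" where
  "fibre_box = cball 0 1 \<times> {-1..1} \<times> {1/2..2}"

lemma bounded_fibre_box: "bounded fibre_box"
  unfolding fibre_box_def by (intro bounded_Times) simp_all

lemma compact_fibre_box: "compact (fibre_box :: ('v::euclidean_space \<times> real \<times> real) set)"
  unfolding fibre_box_def by (intro compact_Times) simp_all

lemma lipschitz_on_straighten:
  fixes K :: "(('v::real_normed_vector \<times> real) \<times> real) set"
  assumes "bounded K"
  obtains L where "L-lipschitz_on (K \<times> fibre_box) straighten"
proof -
  define A :: "((('v \<times> real) \<times> real) \<times> ('v \<times> real \<times> real)) set" where "A = K \<times> fibre_box"
  obtain M where M: "M > 0" "\<And>k. k \<in> K \<Longrightarrow> norm k \<le> M" using assms by (auto simp: bounded_pos)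
  note proj = lipschitz_on_compose2[OF _ lipschitz_on_fst] lipschitz_on_compose2[OF _ lipschitz_on_snd]
    lipschitz_on_id
  \<comment> \<open>The constants stay unevaluated, in the shape that \<open>proj\<close> produces:
    one factor for each projection and one for the identity.\<close>
  have x': "(1*(1*(1*1)))-lipschitz_on A (\<lambda>p. fst (fst (fst p)))" by (rule proj)+
  have x: "(1*(1*(1*1)))-lipschitz_on A (\<lambda>p. snd (fst (fst p)))" by (rule proj)+
  have t: "(1*(1*1))-lipschitz_on A (\<lambda>p. snd (fst p))" by (rule proj)+
  have q: "(1*(1*1))-lipschitz_on A (\<lambda>p. fst (snd p))" by (rule proj)+
  have u: "(1*(1*(1*1)))-lipschitz_on A (\<lambda>p. fst (snd (snd p)))" by (rule proj)+
  have v: "(1*(1*(1*1)))-lipschitz_on A (\<lambda>p. snd (snd (snd p)))" by (rule proj)+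
  have quv: "(1*1)-lipschitz_on A (\<lambda>p. snd p)" by (rule proj)+
  have bt: "\<bar>snd (fst p)\<bar> \<le> M" if "p \<in> A" for p
    using that M(2)[of "fst p"] norm_snd_le[of "snd (fst p)" "fst (fst p)"] by (auto simp: A_def)
  have bq: "norm (fst (snd p)) \<le> 1" and bu: "\<bar>fst (snd (snd p))\<bar> \<le> 1"
    and bv: "snd (snd (snd p)) \<in> {1/2..}" if "p \<in> A" for p
    using that by (auto simp: A_def fibre_box_def)
  have biv: "norm (inverse (snd (snd (snd p)))) \<le> 2" if "p \<in> A" for p
    using bv[OF that] le_imp_inverse_le[of "1/2" "snd (snd (snd p))"] by simp
  have iv: "(4*(1*(1*(1*1))))-lipschitz_on A (\<lambda>p. inverse (snd (snd (snd p))))"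
    by (rule lipschitz_on_compose2[OF v lipschitz_on_subset[OF lipschitz_on_inverse]]) (use bv in blast)
  note tq = lipschitz_on_scaleR[OF t bt _ q bq]
  note uv = lipschitz_on_scaleR[OF u bu _ iv biv]
  note at = lipschitz_on_compose2[OF uv lipschitz_on_arctan]
  note all = lipschitz_on_Pair[OF lipschitz_on_Pair[OF lipschitz_on_Pair[OF lipschitz_on_add[OF x' tq]
      lipschitz_on_diff[OF at x]] t] quv]
  \<comment> \<open>The quotient is rewritten as \<open>scaleR\<close> by \<open>inverse\<close>, to
    match the rules collected in \<open>all\<close>.\<close>
  have eq: "straighten = (\<lambda>p :: (('v \<times> real) \<times> real) \<times> ('v \<times> real \<times> real).
      (((fst (fst (fst p)) + snd (fst p) *\<^sub>R fst (snd p),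
      arctan (fst (snd (snd p)) *\<^sub>R inverse (snd (snd (snd p)))) - snd (fst (fst p))),
      snd (fst p)), snd p))"
    by (rule ext) (simp add: straighten_def case_prod_unfold divide_inverse)
  have "\<exists>L. L-lipschitz_on A straighten"
    unfolding eq by (rule exI, rule all) (use M(1) in simp_all)
  then show thesis using that unfolding A_def by blast
qed

section \<open>Segments in the straightened set\<close>

lemma inner_One_Basis:
  fixes b :: "'a::euclidean_space"
  assumes "b \<in> Basis"
  shows "One \<bullet> b = 1"
  using inner_sum_left_Basis[OF assms, of "\<lambda>_. 1"] by simp

lemma tan_boxI:
  fixes y :: "(real^'m::finite) \<times> real"
  assumes "norm y \<le> 0.1"
  shows "y \<in> tan_box"
proof -
  have "- 0.1 \<le> y \<bullet> i \<and> y \<bullet> i \<le> 0.1" if "i \<in> Basis" for i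
    using Basis_le_norm[OF that, of y] assms by linarith
  then show ?thesis by (simp add: tan_box_def mem_box inner_One_Basis)
qed

lemma tan_box_snd:
  fixes w :: "(real^'m::finite) \<times> real"
  assumes "w \<in> tan_box"
  shows "\<bar>snd w\<bar> \<le> 0.1"
proof -
  have b: "((0, 1) :: (real^'m) \<times> real) \<in> Basis" by (simp add: Basis_prod_def)
  have "One \<bullet> ((0, 1) :: (real^'m) \<times> real) = 1" by (rule inner_One_Basis) (rule b)
  moreover have "w \<bullet> (0, 1) = snd w" by (simp add: inner_prod_def)
  moreover note bnd = bspec[OF assms[unfolded tan_box_def mem_box] b]
  ultimately show ?thesis
    using bnd[THEN conjunct1] bnd[THEN conjunct2] unfolding inner_minus_left inner_scaleR_left
    by linarith
qed

text \<open>The argument of the product \<open>(v + i u) (t + i \<omega>)\<close>.\<close>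

lemma arctan_rotation:
  fixes u v t \<omega> :: real
  assumes v: "0 < v" and uv: "\<bar>u\<bar> \<le> v" "\<bar>\<omega>\<bar> < t"
  shows "arctan ((t * u + v * \<omega>) / (t * v - u * \<omega>)) = arctan (u / v) + arctan (\<omega> / t)"
proof -
  have t: "t > 0" using uv by simp
  have "\<bar>u * \<omega>\<bar> < v * t"
  proof -
    have "\<bar>u\<bar> * \<bar>\<omega>\<bar> \<le> v * \<bar>\<omega>\<bar>" using uv by (intro mult_right_mono) auto
    also have "\<dots> < v * t" using uv v by (intro mult_strict_left_mono) auto
    finally show ?thesis by (simp add: abs_mult)
  qed
  then have d: "t * v - u * \<omega> > 0" by (simp add: abs_less_iff mult.commute)
  have "arctan (u / v) + arctan (\<omega> / t) = arctan ((u / v + \<omega> / t) / (1 - u / v * (\<omega> / t)))"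
    using uv v t by (intro arctan_add) (simp_all add: abs_divide)
  also have "1 - u / v * (\<omega> / t) = (t * v - u * \<omega>) / (t * v)" using v t by (simp add: field_simps)
  also have "u / v + \<omega> / t = (t * u + v * \<omega>) / (t * v)" using v t by (simp add: field_simps)
  also have "(t * u + v * \<omega>) / (t * v) / ((t * v - u * \<omega>) / (t * v))
      = (t * u + v * \<omega>) / (t * v - u * \<omega>)" using v t by simp
  finally show ?thesis by simp
qed

text \<open>The central direction moves only in \<open>t\<close> and \<open>v\<close>, with no
  rotation. For a nearby \<open>e\<close>, the slopes of \<open>q\<close> and \<theta> select the
  curve parameter \<open>y\<close>, those of \<open>u\<close> and \<open>v\<close> the rotation, and
  that of \<open>p\<close> the initial value of \<open>q\<close>. The tolerance \<open>1/100\<close>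
  keeps \<open>y\<close> in \<open>tan_box\<close> and the fibre coordinates in
  \<open>fibre_box\<close>.\<close>

lemma straighten_contains_segment:
  fixes K :: "(((real^'m::finite) \<times> real) \<times> real) set"
  assumes K: "X_Kakeya_set X_tan tan_box {0.9..1.1} tan_box K"
    and e: "norm (e - (((0, 0), 1), (0, 0, 1))) < 1/100"
  shows "\<exists>a r. 0 < r \<and> closed_segment a (a + r *\<^sub>R e) \<subseteq> straighten ` (K \<times> fibre_box)"
proof -
  obtain p0 z0 \<tau> q0 u0 v0 where e_eq: "e = (((p0, z0), \<tau>), (q0, u0, v0))" by (metis prod.exhaust)
  have diff: "e - (((0, 0), 1), (0, 0, 1)) = (((p0, z0), \<tau> - 1), (q0, u0, v0 - 1))" by (simp add: e_eq)
  have A: "norm ((p0, z0), \<tau> - 1) < 1/100" "norm (q0, u0, v0 - 1) < 1/100"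
    using e norm_fst_le norm_snd_le unfolding diff by (meson order_le_less_trans)+
  have B: "norm (p0, z0) < 1/100" "norm (\<tau> - 1) < 1/100" "norm q0 < 1/100" "norm (u0, v0 - 1) < 1/100"
    using A norm_fst_le norm_snd_le by (meson order_le_less_trans)+
  have C: "norm p0 < 1/100" "norm z0 < 1/100" "norm u0 < 1/100" "norm (v0 - 1) < 1/100"
    using B norm_fst_le norm_snd_le by (meson order_le_less_trans)+
  \<comment> \<open>Rescaling by \<open>c\<close> gives the direction \<open>t\<close>-component 1,
    so that \<open>t\<close> parametrizes the line.\<close>
  define c where "c = 1 / \<tau>"
  have \<tau>: "99/100 < \<tau>" "\<tau> < 101/100" using B(2) unfolding real_norm_def by linarith+
  then have c: "99/100 < c" "c < (102/100)" "c * \<tau> = 1" by (auto simp: c_def field_simps)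
  define p z q u v where "p = c *\<^sub>R p0" "z = c * z0" "q = c *\<^sub>R q0" "u = c * u0" "v = c * v0"
  note defs = this
  have small: "c * x \<le> 2/100" if "x < 1/100" "0 \<le> x" for x
  proof -
    have "c * x \<le> (102/100) * (1/100)" using that c by (intro mult_mono) auto
    then show ?thesis by simp
  qed
  have np: "norm p \<le> 2/100" and nz: "\<bar>z\<bar> \<le> 2/100" and nq: "norm q \<le> 2/100" and nu: "\<bar>u\<bar> \<le> 2/100"
    using small C B(3) c by (simp_all add: defs abs_mult)
  have nv: "98/100 \<le> v" "v \<le> (105/100)"
  proof -
    have "99/100 < v0" "v0 < 101/100" using C(4) unfolding real_norm_def by linarith+
    then have "99/100 * (99/100) \<le> c * v0" "c * v0 \<le> 102/100 * (101/100)"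
      using c by (intro mult_mono; simp)+
    then show "98/100 \<le> v" "v \<le> (105/100)" by (simp_all add: defs)
  qed
  have ce: "c *\<^sub>R e = (((p, z), 1), (q, u, v))" by (simp add: e_eq defs c)
  \<comment> \<open>The slope \<open>q\<close> cancels the term
    \<open>- t\<^sup>2 *\<^sub>R fst y\<close> of the curve, and \<open>z\<close> becomes the slope
    of \<theta>, since the curve has \<open>- t * snd y\<close> and \<theta> subtracts it.\<close>
  define y where "y = (q, z)"
  have "norm y \<le> norm q + norm z" unfolding y_def by (rule norm_Pair_le)
  then have "y \<in> tan_box" using nq nz by (intro tan_boxI) simp
  then obtain w where w: "w \<in> tan_box" "kakeya_curve X_tan {0.9..1.1} y w \<subseteq> K"
    using K unfolding X_Kakeya_set_def by blast
  define \<omega> where "\<omega> = snd w"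
  have \<omega>: "\<bar>\<omega>\<bar> \<le> 0.1" unfolding \<omega>_def by (rule tan_box_snd) (rule w)
  \<comment> \<open>The point of the line at \<open>t = 0\<close>. Its last two entries are the
    imaginary and real parts of (v + i u)(t + i \<omega>) there.\<close>
  define a where "a = (((fst w, arctan (u / v)), 0::real), (p, v * \<omega>, - (u * \<omega>)))"
  have mem: "a + t *\<^sub>R (c *\<^sub>R e) \<in> straighten ` (K \<times> fibre_box)" if t: "t \<in> {0.9..1.1}" for t
  proof -
    have "(X_tan w t y, t) \<in> K" using w(2) t unfolding kakeya_curve_def by blast
    moreover have "(p + t *\<^sub>R q, t * u + v * \<omega>, t * v - u * \<omega>) \<in> fibre_box"
    proof -
      have "norm (t *\<^sub>R q) \<le> 1.1 * (2/100)" unfolding norm_scaleR using t nq by (intro mult_mono) auto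
      then have "norm (p + t *\<^sub>R q) \<le> 1" using np norm_triangle_ineq[of p "t *\<^sub>R q"] by simp
      moreover have "\<bar>t * u\<bar> \<le> 1.1 * (2/100)" unfolding abs_mult using t nu by (intro mult_mono) auto
      moreover have "\<bar>v * \<omega>\<bar> \<le> (105/100) * 0.1" unfolding abs_mult using nv \<omega> by (intro mult_mono) auto
      moreover have "\<bar>u * \<omega>\<bar> \<le> 2/100 * 0.1" unfolding abs_mult using nu \<omega> by (intro mult_mono) auto
      moreover have "0.9 * (98/100) \<le> t * v" "t * v \<le> 1.1 * (105/100)"
        using t nv by (intro mult_mono; simp)+
      ultimately show ?thesis by (simp add: fibre_box_def) (intro conjI; linarith)
    qed
    moreover have "a + t *\<^sub>R (c *\<^sub>R e)
        = straighten ((X_tan w t y, t), (p + t *\<^sub>R q, t * u + v * \<omega>, t * v - u * \<omega>))"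
    proof -
      have "arctan ((t * u + v * \<omega>) / (t * v - u * \<omega>)) = arctan (u / v) + arctan (\<omega> / t)"
        using nu nv \<omega> t by (intro arctan_rotation) auto
      then show ?thesis
        by (simp add: straighten_def X_tan_def ce a_def y_def \<omega>_def algebra_simps power2_eq_square)
    qed
    ultimately show ?thesis by blast
  qed
  \<comment> \<open>The line is cut to the parameter range from 0.9 to 1.1, the only one over which
    \<open>K\<close> contains the curve.\<close>
  have "closed_segment (a + (0.9 * c) *\<^sub>R e) (a + (0.9 * c) *\<^sub>R e + (0.2 * c) *\<^sub>R e)
      \<subseteq> straighten ` (K \<times> fibre_box)"
  proof
    fix x assume "x \<in> closed_segment (a + (0.9 * c) *\<^sub>R e) (a + (0.9 * c) *\<^sub>R e + (0.2 * c) *\<^sub>R e)"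
    then obtain l where l: "0 \<le> l" "l \<le> 1" "x = (1 - l) *\<^sub>R (a + (0.9 * c) *\<^sub>R e)
        + l *\<^sub>R (a + (0.9 * c) *\<^sub>R e + (0.2 * c) *\<^sub>R e)" by (auto simp: in_segment)
    have "(1 - l) *\<^sub>R b + l *\<^sub>R (b + d) = b + l *\<^sub>R d" for b d :: "(((real^'m) \<times> real) \<times> real) \<times> ((real^'m) \<times> real \<times> real)"
      by (simp add: algebra_simps)
    then have "x = a + (0.9 * c) *\<^sub>R e + l *\<^sub>R ((0.2 * c) *\<^sub>R e)" unfolding l(3) .
    also have "\<dots> = a + (0.9 + 0.2 * l) *\<^sub>R (c *\<^sub>R e)"
      by (simp add: algebra_simps)
    finally show "x \<in> straighten ` (K \<times> fibre_box)" using mem[of "0.9 + 0.2 * l"] l by simp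
  qed
  then show ?thesis using c by (intro exI[of _ "a + (0.9 * c) *\<^sub>R e"] exI[of _ "0.2 * c"]) simp
qed

section \<open>From an open set of directions to all directions\<close>

text \<open>Finitely many rotated copies of the set catch all directions.\<close>

lemma kakeya_set_from_open_directions:
  fixes S :: "'e::euclidean_space set"
  assumes S: "compact S" and dim: "DIM('e) = CARD('k::finite)" and e0: "e0 \<noteq> 0" and \<delta>: "\<delta> > 0"
    and seg: "\<And>e. norm (e - e0) < \<delta> \<Longrightarrow> \<exists>a r. 0 < r \<and> closed_segment a (a + r *\<^sub>R e) \<subseteq> S"
  obtains T :: "(real^'k) set" where "compact T" "contains_segment_in_each_direction T"
    "\<And>s. s > 0 \<Longrightarrow> cover_null s S \<Longrightarrow> cover_null s T"
proof -
  have "DIM('e) = DIM(real^'k)" using dim by simp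
  then obtain f :: "'e \<Rightarrow> real^'k" and g where fg: "linear f" "linear g"
    "\<And>x. norm (f x) = norm x" "\<And>x. norm (g x) = norm x" "\<And>x. g (f x) = x" "\<And>x. f (g x) = x"
    by (rule isomorphisms_UNIV_UNIV) blast
  \<comment> \<open>Orthogonal maps preserve norms, so \<open>f e0\<close> can be rotated onto
    \<open>R *\<^sub>R e\<close> for a unit vector \<open>e\<close>. Balls of radius
    \<open>\<delta> / R\<close> on the unit sphere then correspond to the tolerance \<delta> around
    \<open>e0\<close>.\<close>
  define R where "R = norm e0"
  have R: "R > 0" using e0 by (simp add: R_def)
  have "\<exists>Q. norm e = 1 \<longrightarrow> orthogonal_transformation Q \<and> Q (f e0) = R *\<^sub>R e" for e :: "real^'k"
  proof (cases "norm e = 1")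
    case True
    then have "norm (f e0) = norm (R *\<^sub>R e)" using R by (simp add: fg R_def)
    then show ?thesis by (rule orthogonal_transformation_exists) blast
  qed blast
  then have "\<exists>Q. \<forall>e :: real^'k. norm e = 1 \<longrightarrow> orthogonal_transformation (Q e) \<and> Q e (f e0) = R *\<^sub>R e"
    by (intro choice allI)
  then obtain Q :: "real^'k \<Rightarrow> real^'k \<Rightarrow> real^'k"
    where Q: "\<And>e. norm e = 1 \<Longrightarrow> orthogonal_transformation (Q e)"
      "\<And>e. norm e = 1 \<Longrightarrow> Q e (f e0) = R *\<^sub>R e" by blast
  define N :: "(real^'k) set" where "N = sphere 0 1"
  have "compact N" unfolding N_def by (rule compact_sphere)
  moreover have "open (ball e (\<delta> / R))" if "e \<in> N" for e by (rule open_ball)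
  moreover have "N \<subseteq> (\<Union>e\<in>N. ball e (\<delta> / R))"
  proof
    fix e assume "e \<in> N"
    moreover have "e \<in> ball e (\<delta> / R)" using R \<delta> by simp
    ultimately show "e \<in> (\<Union>e\<in>N. ball e (\<delta> / R))" by (rule UN_I)
  qed
  ultimately obtain F where F: "F \<subseteq> N" "finite F" "N \<subseteq> (\<Union>e\<in>F. ball e (\<delta> / R))"
    by (rule compactE_image)
  obtain e1 :: "real^'k" where "norm e1 = 1" using vector_choose_size[of 1] zero_le_one by metis
  then have "e1 \<in> N" by (simp add: N_def)
  then have F0: "F \<noteq> {}" using F(3) by auto
  define h where "h e = Q e \<circ> f" for e
  have h: "linear (h e)" "\<And>x. norm (h e x) = norm x" if "e \<in> F" for e
  proof -
    have "orthogonal_transformation (Q e)" using that F(1) by (intro Q(1)) (auto simp: N_def)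
    then show "linear (h e)" "\<And>x. norm (h e x) = norm x" unfolding h_def
      by (simp_all add: linear_compose fg orthogonal_transformation_linear orthogonal_transformation_norm)
  qed
  have lip: "1-lipschitz_on S (h e)" if "e \<in> F" for e
    using h[OF that] by (intro lipschitz_onI) (simp_all add: dist_norm linear_diff[symmetric, of "h e"])
  define T where "T = (\<Union>e\<in>F. h e ` S)"
  show thesis
  proof (rule that)
    show "compact T" unfolding T_def
      using F(2) S by (intro compact_UN compact_continuous_image lipschitz_on_continuous_on[OF lip])
    show "cover_null s T" if "s > 0" "cover_null s S" for s
      unfolding T_def using F(2) F0 cover_null_lipschitz_image[OF that(2) lip that(1)]
      by (intro cover_null_finite_UN)
    show "contains_segment_in_each_direction T"
      unfolding contains_segment_in_each_direction_def
    proof (intro allI impI)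
      fix e :: "real^'k" assume e: "norm e = 1"
      then have "e \<in> N" by (simp add: N_def)
      then obtain e' where e': "e' \<in> F" "e \<in> ball e' (\<delta> / R)" using F(3) by (meson UN_E subsetD)
      then have ne': "norm e' = 1" using F(1) by (auto simp: N_def)
      have "surj (Q e')" using Q(1)[OF ne'] by (rule orthogonal_transformation_surj)
      then obtain x where x: "R *\<^sub>R e = Q e' x" by (rule surjE)
      \<comment> \<open>\<open>d\<close> is the preimage of \<open>R *\<^sub>R e\<close> under the
        isometry \<open>h e'\<close>, which sends \<open>e0\<close> to
        \<open>R *\<^sub>R e'\<close>; so \<open>d\<close> is within \<delta> of
        \<open>e0\<close>.\<close>
      define d where "d = g x"
      have hd: "h e' d = R *\<^sub>R e" by (simp add: h_def d_def fg x)
      have he0: "h e' e0 = R *\<^sub>R e'" using Q(2)[OF ne'] by (simp add: h_def)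
      have "norm (d - e0) = norm (h e' (d - e0))" using h(2)[OF e'(1)] by simp
      also have "\<dots> = norm (R *\<^sub>R (e - e'))"
        using h(1)[OF e'(1)] by (simp add: linear_diff hd he0 scaleR_right_diff_distrib)
      also have "\<dots> = R * dist e' e" using R by (simp add: dist_norm norm_minus_commute)
      also have "\<dots> < \<delta>" using e'(2) R by (simp add: field_simps)
      finally obtain a r where ar: "0 < r" "closed_segment a (a + r *\<^sub>R d) \<subseteq> S" using seg by blast
      have "closed_segment (h e' a) (h e' (a + r *\<^sub>R d)) = h e' ` closed_segment a (a + r *\<^sub>R d)"
        using h(1)[OF e'(1)] by (rule closed_segment_linear_image)
      also have "\<dots> \<subseteq> h e' ` S" using ar(2) by (rule image_mono)
      also have "\<dots> \<subseteq> T" unfolding T_def using e'(1) by (rule UN_upper)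
      also have "h e' (a + r *\<^sub>R d) = h e' a + (r * R) *\<^sub>R e"
        using h(1)[OF e'(1)] by (simp add: linear_add linear_scale hd)
      finally show "\<exists>a r. 0 < r \<and> closed_segment a (a + r *\<^sub>R e) \<subseteq> T"
        using ar(1) R by (intro exI[of _ "h e' a"] exI[of _ "r * R"]) simp
    qed
  qed
qed

section \<open>Dimension of the Kakeya sets of \<open>X_tan\<close>\<close>

text \<open>If \<open>K\<close> were null for some \<open>s < n\<close>, then its
  \<open>n\<close>-dimensional thickening, the Lipschitz image \<open>S\<close> and the linear
  Kakeya set \<open>T\<close> would be null for \<open>s + n < 2 * n\<close>, against the
  conjecture.\<close>

lemma X_tan_Kakeya_set_dim_ge:
  fixes K :: "(((real^'m::finite) \<times> real) \<times> real) set"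
  assumes conj: "linear_kakeya_set_conjecture TYPE(real^'k::finite)"
    and k: "CARD('k) = 2 * (CARD('m) + 2)"
    and K: "X_Kakeya_set X_tan tan_box {0.9..1.1} tan_box K"
  shows "of_nat (CARD('m) + 2) \<le> hausdorff_dim K"
proof (rule ccontr)
  define n where "n = CARD('m) + 2"
  assume "\<not> of_nat (CARD('m) + 2) \<le> hausdorff_dim K"
  then have "hausdorff_dim K < of_nat n" by (simp add: n_def)
  then obtain s where s: "s > 0" "ennreal s < of_nat n" "cover_null s K"
    by (rule cover_null_if_hausdorff_dim_less)
  define B :: "((real^'m) \<times> real \<times> real) set" where "B = fibre_box"
  have comp: "compact (K \<times> B)" and bK: "bounded K"
    using K by (auto simp: X_Kakeya_set_def B_def intro!: compact_Times compact_fibre_box compact_imp_bounded)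
  obtain L where L: "L-lipschitz_on (K \<times> B) straighten"
    unfolding B_def using lipschitz_on_straighten[OF bK] by blast
  define S where "S = straighten ` (K \<times> B)"
  have "compact S" unfolding S_def
    using lipschitz_on_continuous_on[OF L] comp by (rule compact_continuous_image)
  have "cover_null (s + real DIM((real^'m) \<times> real \<times> real)) (K \<times> B)"
    using s(3,1) unfolding B_def by (rule cover_null_Times) (rule bounded_fibre_box)
  then have "cover_null (s + n) (K \<times> B)" by (simp add: n_def add.commute)
  then have S: "cover_null (s + n) S" unfolding S_def
    using L s(1) by (intro cover_null_lipschitz_image) simp_all
  obtain T :: "(real^'k) set" where T: "compact T" "contains_segment_in_each_direction T"
    "\<And>s. s > 0 \<Longrightarrow> cover_null s S \<Longrightarrow> cover_null s T"
  proof (rule kakeya_set_from_open_directions)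
    show "compact S" by fact
    show "DIM((((real^'m) \<times> real) \<times> real) \<times> ((real^'m) \<times> real \<times> real)) = CARD('k)"
      using k by simp
    show "\<exists>a r. 0 < r \<and> closed_segment a (a + r *\<^sub>R e) \<subseteq> S"
      if "norm (e - (((0, 0), 1), (0, 0, 1))) < 1/100" for e
      unfolding S_def B_def using K that by (rule straighten_contains_segment)
  qed (simp_all add: zero_prod_def)
  have "hausdorff_dim T = of_nat DIM(real^'k)"
    using conj T(1,2) unfolding linear_kakeya_set_conjecture_def by blast
  moreover have "hausdorff_dim T \<le> ennreal (s + n)"
    using T(3)[OF _ S] s(1) by (intro hausdorff_dim_le) simp_all
  ultimately have "ennreal (real (2 * n)) \<le> ennreal (s + n)"
    using k by (simp add: n_def ennreal_of_nat_eq_real_of_nat)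
  then have "real (2 * n) \<le> s + n" using s(1) by (subst (asm) ennreal_le_iff) simp_all
  moreover have "s < n" using s(1,2) by (simp add: ennreal_of_nat_eq_real_of_nat ennreal_less_iff)
  ultimately show False by simp
qed

text \<open>Without such a set the infimum in \<open>d_Kak\<close> would be infinite. Choosing
  \<open>w = 0\<close> for all \<open>y\<close> gives a continuous image of a compact set.\<close>

lemma X_tan_Kakeya_set_exists:
  "\<exists>K :: (((real^'m::finite) \<times> real) \<times> real) set. X_Kakeya_set X_tan tan_box {0.9..1.1} tan_box K"
proof -
  define \<phi> :: "((real^'m) \<times> real) \<times> real \<Rightarrow> ((real^'m) \<times> real) \<times> real"
    where "\<phi> = (\<lambda>(y, t). (X_tan 0 t y, t))"
  have "continuous_on (tan_box \<times> {0.9..1.1}) \<phi>"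
    unfolding \<phi>_def X_tan_def case_prod_unfold by (simp, intro continuous_intros)
  moreover have "compact (tan_box \<times> {0.9..1.1} :: (((real^'m) \<times> real) \<times> real) set)"
    unfolding tan_box_def by (intro compact_Times compact_cbox compact_Icc)
  ultimately have "compact (\<phi> ` (tan_box \<times> {0.9..1.1}))" by (rule compact_continuous_image)
  moreover have "(0 :: (real^'m) \<times> real) \<in> tan_box" by (rule tan_boxI) simp
  moreover have "kakeya_curve X_tan {0.9..1.1} y 0 \<subseteq> \<phi> ` (tan_box \<times> {0.9..1.1})" if "y \<in> tan_box" for y
  proof
    fix x assume "x \<in> kakeya_curve X_tan {0.9..1.1} y 0"
    then obtain t where "x = \<phi> (y, t)" "t \<in> {0.9..1.1}" by (auto simp: kakeya_curve_def \<phi>_def)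
    then show "x \<in> \<phi> ` (tan_box \<times> {0.9..1.1})" using that by (auto intro: image_eqI[of _ _ "(y, t)"])
  qed
  ultimately have "X_Kakeya_set X_tan tan_box {0.9..1.1} tan_box (\<phi> ` (tan_box \<times> {0.9..1.1}))"
    unfolding X_Kakeya_set_def by blast
  then show ?thesis ..
qed

theorem theorem1p7:
  fixes n :: nat
  assumes "n \<ge> 3"
    and "CARD('m::finite) = n - 2"
    and "CARD('k::finite) = 2 * n"
    and "linear_kakeya_set_conjecture TYPE(real^'k)"
  shows "d_Kak (X_tan :: (real^'m) \<times> real \<Rightarrow> real \<Rightarrow> (real^'m) \<times> real \<Rightarrow> (real^'m) \<times> real)
           tan_box {0.9..1.1} tan_box = of_nat n"
proof (rule antisym)
  have n: "n = CARD('m) + 2" using assms(1,2) by simp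
  \<comment> \<open>The upper bound comes from a single Kakeya set: being bounded in a space of
    dimension \<open>n\<close>, it has dimension at most \<open>n\<close>.\<close>
  obtain K :: "(((real^'m) \<times> real) \<times> real) set"
    where K: "X_Kakeya_set X_tan tan_box {0.9..1.1} tan_box K"
    using X_tan_Kakeya_set_exists by blast
  then have "bounded K" by (simp add: X_Kakeya_set_def compact_imp_bounded)
  then have "hausdorff_dim K \<le> of_nat DIM(((real^'m) \<times> real) \<times> real)"
    by (rule hausdorff_dim_bounded_le)
  then have "hausdorff_dim K \<le> of_nat n" by (simp add: n add.commute)
  then show "d_Kak (X_tan :: (real^'m) \<times> real \<Rightarrow> real \<Rightarrow> (real^'m) \<times> real \<Rightarrow> (real^'m) \<times> real)
           tan_box {0.9..1.1} tan_box \<le> of_nat n"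
    unfolding d_Kak_def using K by (intro INF_lower2[of K]) simp_all
  show "of_nat n \<le> d_Kak (X_tan :: (real^'m) \<times> real \<Rightarrow> real \<Rightarrow> (real^'m) \<times> real \<Rightarrow> (real^'m) \<times> real)
           tan_box {0.9..1.1} tan_box"
    unfolding d_Kak_def n using assms(3,4) n
    by (intro INF_greatest X_tan_Kakeya_set_dim_ge) simp_all
qed

end
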